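(* Suppose $d\geq 2$ and $f:[0,4]\to(-\infty,\infty]$ is a function continuous on $(0,4]$, differentiable in $(0,4)$ with a concave derivative $f'$ on $(0,4)$, such that $\lim_{t\to 0^+}f(t)=f(0)$. Let $\omega_d^\ast$ be the set of vertices of a regular $d$-simplex inscribed in $S^{d-1}$. Then the absolute minimum of the potential $p_f(\mathbf x,\omega_d^\ast)$ over $\mathbf x\in S^{d-1}$ is achieved at every point of the set $-\omega_d^\ast$. Furthermore, $$P_f(\omega_d^\ast,S^{d-1})=\min_{\mathbf x\in S^{d-1}}p_f(\mathbf x,\omega_d^\ast)=f(4)+d\cdot f\left(2-\frac{2}{d}\right).\qquad(1)$$ If, in addition, $f(0)<\infty$, then the absolute maximum of the potential $p_f(\mathbf x,\omega_d^\ast)$ over $\mathbf x\in S^{d-1}$ is achieved at every point of $\omega_d^\ast$, with $$\max_{\mathbf x\in S^{d-1}}p_f(\mathbf x,\omega_d^\ast)=f(0)+d\cdot f\left(2+\frac{2}{d}\right).\qquad(2)$$ If the concavity of $f'$ is strict on $(0,4)$, then the minimum in (1) is attained only at the points of $-\omega_d^\ast$, and the maximum in (2) is attained only at the points of $\omega_d^\ast$.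
   Context: $S^{d-1}=\{\mathbf x\in\mathbb R^d: |\mathbf x|=1\}$, where $|\cdot|$ is the Euclidean norm. The vertices $\omega_d^\ast=\{\mathbf x_0,\ldots,\mathbf x_d\}$ of a regular $d$-simplex inscribed in $S^{d-1}$ are $d+1$ points of $S^{d-1}$ whose pairwise distances are all equal (equivalently, distinct vertices have inner product $-1/d$); $-\omega_d^\ast=\{-\mathbf x_0,\ldots,-\mathbf x_d\}$ is the set of antipodes. The potential is $$p_f(\mathbf x,\omega_d^\ast)=\sum_{i=0}^{d} f(|\mathbf x-\mathbf x_i|^2),\ \ \mathbf x\in S^{d-1},$$ and $P_f(\omega_d^\ast,S^{d-1})=\min_{\mathbf x\in S^{d-1}}p_f(\mathbf x,\omega_d^\ast)$. The function $f$ is finite on $(0,4]$; only $f(0)$ may be $\infty$, and the limit at $0$ is understood in the extended sense. *)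

theory Defs
  imports "HOL-Analysis.Analysis"
begin

(* The space R^d is real ^ 'd with d = CARD('d); S^(d-1) is sphere 0 1 in it. *)

definition regular_simplex_vertices :: "(real ^ 'd) set \<Rightarrow> bool" where
  "regular_simplex_vertices \<omega> \<longleftrightarrow>
     \<omega> \<subseteq> sphere 0 1 \<and> card \<omega> = CARD('d) + 1 \<and>
     (\<exists>c. \<forall>x\<in>\<omega>. \<forall>y\<in>\<omega>. x \<noteq> y \<longrightarrow> dist x y = c)"

(* A function [0,4] -> (-\<infinity>,\<infinity>] is a total function real \<Rightarrow> ereal; on unit vectors
   it is only ever evaluated in [0,4]. *)
definition potential :: "(real \<Rightarrow> ereal) \<Rightarrow> (real ^ 'd) set \<Rightarrow> real ^ 'd \<Rightarrow> ereal" where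
  "potential f \<omega> x = (\<Sum>y\<in>\<omega>. f ((norm (x - y))\<^sup>2))"

(* Minimum and maximum are the least and the greatest value attained. LEAST and GREATEST are
   unspecified where no such value exists, so that the extremum is attained has to be
   claimed separately, through is_arg_min and is_arg_max. *)
definition min_potential :: "(real \<Rightarrow> ereal) \<Rightarrow> (real ^ 'd) set \<Rightarrow> ereal" where
  "min_potential f \<omega> = (LEAST v. v \<in> potential f \<omega> ` sphere 0 1)"

definition max_potential :: "(real \<Rightarrow> ereal) \<Rightarrow> (real ^ 'd) set \<Rightarrow> ereal" where
  "max_potential f \<omega> = (GREATEST v. v \<in> potential f \<omega> ` sphere 0 1)"

definition strictly_concave_on :: "real set \<Rightarrow> (real \<Rightarrow> real) \<Rightarrow> bool" where
  "strictly_concave_on S g \<longleftrightarrow> convex S \<and>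
     (\<forall>x\<in>S. \<forall>y\<in>S. \<forall>u>0. \<forall>v>0. x \<noteq> y \<longrightarrow> u + v = 1 \<longrightarrow>
        u * g x + v * g y < g (u * x + v * y))"

end

theory Submission
  imports Defs
begin

text \<open>
  Why the theorem is true. A regular simplex is a spherical 2-design: for unit \<open>x\<close>, the sums of
  the inner products \<open>x \<bullet> y\<close> over the vertices \<open>y\<close>, and of their squares, do not depend
  on \<open>x\<close>. Since \<open>|x - y|\<^sup>2 = 2 - 2 (x \<bullet> y)\<close>, every quadratic polynomial in the
  squared distance therefore has a constant potential on the sphere
  (\<open>quadratic_potential_constant\<close>).

  From an antipode of a vertex only two squared distances occur: \<open>4\<close> once, and
  \<open>2 - 2/d\<close> at the other \<open>d\<close> vertices. Let \<open>h\<close> be the quadratic polynomial that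
  agrees with \<open>f\<close> at \<open>4\<close>, and to first order at \<open>c = 2 - 2/d\<close>. If \<open>f\<close> is
  smooth, \<open>f(t) - h(t) = f'''(\<xi>)/6 (t - c)\<^sup>2 (t - 4)\<close> for some \<open>\<xi>\<close>; this is
  nonnegative because concavity of \<open>f'\<close> means \<open>f''' \<le> 0\<close>. Without smoothness,
  \<open>hermite_quadratic_le\<close> obtains \<open>h \<le> f\<close> from the mean value theorem and concavity of the
  derivative. Summing over the vertices, the potential of \<open>f\<close> is at least the constant potential
  of \<open>h\<close>, and the two agree at the antipodes. With strict concavity, equality at \<open>x\<close> forces
  every squared distance to be one of the two nodes, and that happens only at the antipodes
  (\<open>exists_off_node_distance\<close>).

  The maximum is the same statement reflected. Because \<open>|x - y|\<^sup>2 + |-x - y|\<^sup>2 = 4\<close> on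
  the sphere, the potential of \<open>f\<close> at \<open>x\<close> is the negative of the potential of
  \<open>g(s) = -f(4 - s)\<close> at \<open>-x\<close> (\<open>potential_reflection\<close>), and \<open>g'(s) = f'(4 - s)\<close>
  is again concave.
\<close>

section \<open>Quadratic Hermite interpolation\<close>

text \<open>
  The mean value theorem between consecutive nodes turns a value \<open>\<phi> t\<close> of the wrong sign into a
  dip of the derivative, a pattern \<open>+ - +\<close> that concavity rules out. The node \<open>c\<close>
  supplies one of the three points by itself, as the derivative vanishes there: it is the left one if
  \<open>c < t\<close> and the middle one if \<open>t < c\<close>. The last conclusion keeps track of one strict
  sign, which is what contradicts concavity that is not strict.
\<close>
lemma three_point_sign_pattern:
  fixes \<phi> \<phi>' :: "real \<Rightarrow> real"
  assumes cont: "continuous_on {a..b} \<phi>"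
    and deriv: "\<And>s. s \<in> {a<..<b} \<Longrightarrow> (\<phi> has_real_derivative \<phi>' s) (at s)"
    and c: "a < c" "c < b"
    and zeros: "\<phi> c = 0" "\<phi>' c = 0" "\<phi> b = 0"
    and t: "t \<in> {a..b}" "t \<noteq> c" "t \<noteq> b" "\<phi> t \<le> 0"
  obtains x y z where "a < x" "x < y" "y < z" "z < b"
    "\<phi>' x \<ge> 0" "\<phi>' y \<le> 0" "\<phi>' z \<ge> 0" "\<phi> t < 0 \<Longrightarrow> \<phi>' y < 0 \<or> \<phi>' x > 0"
proof -
  have mvt: "\<exists>s. l < s \<and> s < r \<and> \<phi> r - \<phi> l = (r - l) * \<phi>' s"
    if "a \<le> l" "l < r" "r \<le> b" for l r
  proof -
    have "continuous_on {l..r} \<phi>"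
      using cont by (rule continuous_on_subset) (use that in auto)
    moreover have "(\<phi> has_derivative (*) (\<phi>' s)) (at s)" if "l < s" "s < r" for s
      using deriv[of s] that \<open>a \<le> l\<close> \<open>r \<le> b\<close> by (auto simp: has_field_derivative_def)
    ultimately obtain s where "l < s" "s < r" "\<phi> r - \<phi> l = \<phi>' s * (r - l)"
      using mvt[OF \<open>l < r\<close>, of \<phi> "\<lambda>s. (*) (\<phi>' s)"] by blast
    then show ?thesis by (auto simp: mult.commute)
  qed
  show thesis
  proof (cases "c < t")
    case True
    obtain y where y: "c < y" "y < t" "\<phi> t - \<phi> c = (t - c) * \<phi>' y"
      using mvt[of c t] True c t by auto
    obtain z where z: "t < z" "z < b" "\<phi> b - \<phi> t = (b - t) * \<phi>' z"
      using mvt[of t b] True c t by auto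
    have "(t - c) * \<phi>' y \<le> 0" using y(3) zeros t by simp
    then have "\<phi>' y \<le> 0" using True by (simp add: mult_le_0_iff)
    moreover have "0 \<le> (b - t) * \<phi>' z" using z(3) zeros t by simp
    then have "\<phi>' z \<ge> 0" using t by (simp add: zero_le_mult_iff)
    moreover have "\<phi>' y < 0" if "\<phi> t < 0"
      using y zeros that \<open>\<phi>' y \<le> 0\<close> by (cases "\<phi>' y = 0") auto
    ultimately show thesis
      using that[of c y z] y z zeros c by auto
  next
    case False
    then have "t < c" using t by simp
    obtain x where x: "t < x" "x < c" "\<phi> c - \<phi> t = (c - t) * \<phi>' x"
      using mvt[of t c] \<open>t < c\<close> c t by auto
    obtain z where z: "c < z" "z < b" "\<phi> b - \<phi> c = (b - c) * \<phi>' z"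
      using mvt[of c b] c by auto
    have "0 \<le> (c - t) * \<phi>' x" using x(3) zeros t by simp
    then have "\<phi>' x \<ge> 0" using \<open>t < c\<close> by (simp add: zero_le_mult_iff)
    moreover have "\<phi>' z = 0" using z zeros c by simp
    moreover have "\<phi>' x > 0" if "\<phi> t < 0"
      using x zeros that \<open>\<phi>' x \<ge> 0\<close> by (cases "\<phi>' x = 0") auto
    ultimately show thesis
      using that[of x c z] x z zeros c t by auto
  qed
qed

lemma between_weights:
  fixes x y z :: real
  assumes "x < y" "y < z"
  obtains u v where "u > 0" "v > 0" "u + v = 1" "y = u * x + v * z"
proof -
  have "(z - y) / (z - x) > 0" "(y - x) / (z - x) > 0"
    using assms by auto
  moreover have "(z - y) / (z - x) + (y - x) / (z - x) = 1"
    using assms by (simp flip: add_divide_distrib)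
  moreover have "y = (z - y) / (z - x) * x + (y - x) / (z - x) * z"
    using assms by (simp add: divide_simps) (simp add: algebra_simps)
  ultimately show thesis using that by blast
qed

lemma nonneg_of_double_zero:
  fixes \<phi> \<phi>' :: "real \<Rightarrow> real"
  assumes cont: "continuous_on {a..b} \<phi>"
    and deriv: "\<And>s. s \<in> {a<..<b} \<Longrightarrow> (\<phi> has_real_derivative \<phi>' s) (at s)"
    and c: "a < c" "c < b"
    and zeros: "\<phi> c = 0" "\<phi>' c = 0" "\<phi> b = 0"
    and concave: "concave_on {a<..<b} \<phi>'"
    and t: "t \<in> {a..b}"
  shows "\<phi> t \<ge> 0"
    and "strictly_concave_on {a<..<b} \<phi>' \<Longrightarrow> t \<noteq> c \<Longrightarrow> t \<noteq> b \<Longrightarrow> \<phi> t > 0"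
proof -
  show "\<phi> t \<ge> 0"
  proof (rule ccontr)
    assume "\<not> \<phi> t \<ge> 0"
    then have neg: "\<phi> t < 0" by simp
    then have "t \<noteq> c" "t \<noteq> b" using zeros by auto
    with three_point_sign_pattern[OF cont deriv c zeros t] neg
    obtain x y z where xyz: "a < x" "x < y" "y < z" "z < b"
      and sgn: "\<phi>' x \<ge> 0" "\<phi>' y \<le> 0" "\<phi>' z \<ge> 0" "\<phi>' y < 0 \<or> \<phi>' x > 0"
      by (metis less_imp_le)
    obtain u v where uv: "u > 0" "v > 0" "u + v = 1" "y = u * x + v * z"
      using between_weights xyz by blast
    have "\<phi>' y \<ge> u * \<phi>' x + v * \<phi>' z"
      using concave xyz uv unfolding concave_on_iff by auto
    moreover have "u * \<phi>' x \<ge> 0" "v * \<phi>' z \<ge> 0" "\<phi>' x > 0 \<Longrightarrow> u * \<phi>' x > 0"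
      using uv sgn by auto
    ultimately show False using sgn by linarith
  qed
  show "\<phi> t > 0" if strict: "strictly_concave_on {a<..<b} \<phi>'" and tn: "t \<noteq> c" "t \<noteq> b"
  proof (rule ccontr)
    assume "\<not> \<phi> t > 0"
    then have "\<phi> t \<le> 0" by simp
    with three_point_sign_pattern[OF cont deriv c zeros t tn]
    obtain x y z where xyz: "a < x" "x < y" "y < z" "z < b"
      and sgn: "\<phi>' x \<ge> 0" "\<phi>' y \<le> 0" "\<phi>' z \<ge> 0"
      by metis
    obtain u v where uv: "u > 0" "v > 0" "u + v = 1" "y = u * x + v * z"
      using between_weights xyz by blast
    have "u * \<phi>' x + v * \<phi>' z < \<phi>' y"
      using strict xyz uv unfolding strictly_concave_on_def by auto
    moreover have "u * \<phi>' x \<ge> 0" "v * \<phi>' z \<ge> 0"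
      using uv sgn by auto
    ultimately show False using sgn by linarith
  qed
qed

text \<open>
  The quadratic polynomial with value \<open>F c\<close> and slope \<open>D\<close> at \<open>c\<close>, and with value
  \<open>F b\<close> at \<open>b\<close>.
\<close>
definition hermite_quadratic :: "(real \<Rightarrow> real) \<Rightarrow> real \<Rightarrow> real \<Rightarrow> real \<Rightarrow> real \<Rightarrow> real" where
  "hermite_quadratic F D c b s =
     F c + D * (s - c) + (F b - F c - D * (b - c)) / (b - c)\<^sup>2 * (s - c)\<^sup>2"

lemma hermite_quadratic_nodes:
  "hermite_quadratic F D c b c = F c" "c < b \<Longrightarrow> hermite_quadratic F D c b b = F b"
  by (auto simp: hermite_quadratic_def)

lemma hermite_quadratic_coeffs:
  obtains \<alpha> \<beta> \<gamma> where "\<And>s. hermite_quadratic F D c b s = \<alpha> + \<beta> * s + \<gamma> * s\<^sup>2"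
proof -
  define k where "k = (F b - F c - D * (b - c)) / (b - c)\<^sup>2"
  have "hermite_quadratic F D c b s
      = (F c - D * c + k * c\<^sup>2) + (D - 2 * k * c) * s + k * s\<^sup>2" for s
    unfolding hermite_quadratic_def k_def[symmetric] by (simp add: algebra_simps power2_eq_square)
  then show thesis using that by blast
qed

text \<open>
  The error of the interpolation has a double zero at \<open>c\<close> and a zero at \<open>b\<close>, and its
  derivative differs from \<open>F'\<close> by an affine function, so it inherits (strict) concavity.
\<close>
lemma hermite_quadratic_le:
  fixes F F' :: "real \<Rightarrow> real"
  assumes cont: "continuous_on {a..b} F"
    and deriv: "\<And>s. s \<in> {a<..<b} \<Longrightarrow> (F has_real_derivative F' s) (at s)"
    and c: "a < c" "c < b"
    and concave: "concave_on {a<..<b} F'"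
    and t: "t \<in> {a..b}"
  shows "hermite_quadratic F (F' c) c b t \<le> F t"
    and "strictly_concave_on {a<..<b} F' \<Longrightarrow> t \<noteq> c \<Longrightarrow> t \<noteq> b
      \<Longrightarrow> hermite_quadratic F (F' c) c b t < F t"
proof -
  define k where "k = (F b - F c - F' c * (b - c)) / (b - c)\<^sup>2"
  define \<phi> where "\<phi> s = F s - (F c + F' c * (s - c) + k * (s - c)\<^sup>2)" for s
  define \<phi>' where "\<phi>' s = F' s - (F' c + 2 * k * (s - c))" for s
  have \<phi>: "\<phi> s = F s - hermite_quadratic F (F' c) c b s" for s
    unfolding \<phi>_def k_def hermite_quadratic_def ..
  have zeros: "\<phi> c = 0" "\<phi>' c = 0" "\<phi> b = 0"
    using hermite_quadratic_nodes c by (simp_all add: \<phi>) (simp add: \<phi>'_def)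
  have "continuous_on {a..b} \<phi>"
    unfolding \<phi>_def by (intro continuous_intros cont)
  moreover have "(\<phi> has_real_derivative \<phi>' s) (at s)" if "s \<in> {a<..<b}" for s
    unfolding \<phi>_def \<phi>'_def using deriv[OF that]
    by (auto intro!: derivative_eq_intros)
  moreover
  have affine: "\<phi>' (u * x + v * y) - (u * \<phi>' x + v * \<phi>' y)
      = F' (u * x + v * y) - (u * F' x + v * F' y)" if "u + v = 1" for u v x y
  proof -
    have "u = 1 - v" using that by simp
    show ?thesis unfolding \<phi>'_def \<open>u = 1 - v\<close> by (simp add: algebra_simps)
  qed
  have "concave_on {a<..<b} \<phi>'"
    unfolding concave_on_iff real_scaleR_def
  proof (intro conjI ballI allI impI)
    fix x y u v :: real
    assume "x \<in> {a<..<b}" "y \<in> {a<..<b}" "0 \<le> u" "0 \<le> v" and uv: "u + v = 1"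
    then have "u * F' x + v * F' y \<le> F' (u * x + v * y)"
      using concave unfolding concave_on_iff by auto
    then show "u * \<phi>' x + v * \<phi>' y \<le> \<phi>' (u * x + v * y)"
      using affine[OF uv, of x y] by linarith
  qed (simp add: convex_real_interval)
  moreover have "strictly_concave_on {a<..<b} \<phi>'" if "strictly_concave_on {a<..<b} F'"
    unfolding strictly_concave_on_def
  proof (intro conjI ballI allI impI)
    fix x y u v :: real
    assume "x \<in> {a<..<b}" "y \<in> {a<..<b}" "0 < u" "0 < v" "x \<noteq> y" and uv: "u + v = 1"
    then have "u * F' x + v * F' y < F' (u * x + v * y)"
      using that unfolding strictly_concave_on_def by auto
    then show "u * \<phi>' x + v * \<phi>' y < \<phi>' (u * x + v * y)"
      using affine[OF uv, of x y] by linarith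
  qed (simp add: convex_real_interval)
  ultimately show "hermite_quadratic F (F' c) c b t \<le> F t"
    and "strictly_concave_on {a<..<b} F' \<Longrightarrow> t \<noteq> c \<Longrightarrow> t \<noteq> b
      \<Longrightarrow> hermite_quadratic F (F' c) c b t < F t"
    using nonneg_of_double_zero[of a b \<phi> \<phi>' c t] c zeros t by (auto simp: \<phi>)
qed

section \<open>The regular simplex as a spherical design\<close>

lemma regular_simplex_finite:
  fixes \<omega> :: "(real ^ 'd) set"
  assumes "regular_simplex_vertices \<omega>"
  shows "finite \<omega>"
  using assms by (auto simp: regular_simplex_vertices_def intro: card_ge_0_finite)

lemma regular_simplex_unit:
  assumes "regular_simplex_vertices \<omega>" "y \<in> \<omega>"
  shows "norm y = 1"
  using assms by (auto simp: regular_simplex_vertices_def)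

lemma norm_diff_unit_sq:
  fixes x y :: "'a :: real_inner"
  assumes "norm x = 1" "norm y = 1"
  shows "(norm (x - y))\<^sup>2 = 2 - 2 * (x \<bullet> y)"
  using assms by (simp add: power2_norm_eq_inner norm_eq_1 inner_diff inner_commute)

text \<open>
  Taking the inner product of a linear relation with each vertex in turn shows that, for
  \<open>r \<noteq> 1\<close>, all its coefficients are equal. So the only linear relations between
  equiangular unit vectors are the multiples of \<open>\<Sum>\<omega> = 0\<close>, if that holds at all.
\<close>
lemma equiangular_relation_constant:
  fixes \<omega> :: "'a :: real_inner set"
  assumes fin: "finite \<omega>" and unit: "\<And>y. y \<in> \<omega> \<Longrightarrow> norm y = 1"
    and r: "\<And>x y. x \<in> \<omega> \<Longrightarrow> y \<in> \<omega> \<Longrightarrow> x \<noteq> y \<Longrightarrow> x \<bullet> y = r"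
    and rel: "(\<Sum>y\<in>\<omega>. a y *\<^sub>R y) = 0" and z: "z \<in> \<omega>"
  shows "(1 - r) * a z = - r * sum a \<omega>"
proof -
  have "0 = (\<Sum>y\<in>\<omega>. a y *\<^sub>R y) \<bullet> z" using rel by simp
  also have "\<dots> = (\<Sum>y\<in>\<omega>. a y * (y \<bullet> z))" by (simp add: inner_sum_left)
  also have "\<dots> = a z * (z \<bullet> z) + (\<Sum>y\<in>\<omega> - {z}. a y * (y \<bullet> z))"
    using fin z by (simp add: sum.remove)
  also have "(\<Sum>y\<in>\<omega> - {z}. a y * (y \<bullet> z)) = (\<Sum>y\<in>\<omega> - {z}. a y) * r"
    unfolding sum_distrib_right using r z by (intro sum.cong) auto
  also have "(\<Sum>y\<in>\<omega> - {z}. a y) = sum a \<omega> - a z"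
    using fin z by (simp add: sum_diff1)
  finally show ?thesis using unit[OF z] by (simp add: norm_eq_1 algebra_simps)
qed

text \<open>
  There are more than \<open>d\<close> vertices, so a nontrivial linear relation exists; having equal
  coefficients, it says that the vertices sum to zero. The inner product of this sum with a vertex,
  \<open>1 + d r = 0\<close>, determines \<open>r\<close>. A relation among \<open>d\<close> of the vertices has
  coefficient zero at the remaining one and hence everywhere, so these \<open>d\<close> vertices are a basis.
\<close>
lemma regular_simplex_facts:
  fixes \<omega> :: "(real ^ 'd) set"
  assumes simplex: "regular_simplex_vertices \<omega>"
  shows regular_simplex_inner:
      "\<And>x y. x \<in> \<omega> \<Longrightarrow> y \<in> \<omega> \<Longrightarrow> x \<noteq> y \<Longrightarrow> x \<bullet> y = - 1 / real CARD('d)"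
    and regular_simplex_sum: "\<Sum>\<omega> = 0"
    and regular_simplex_span: "span \<omega> = UNIV"
proof -
  have fin: "finite \<omega>" by (rule regular_simplex_finite[OF simplex])
  have unit: "norm y = 1" if "y \<in> \<omega>" for y
    using regular_simplex_unit[OF simplex that] .
  have card: "card \<omega> = CARD('d) + 1" using simplex by (simp add: regular_simplex_vertices_def)
  have d: "CARD('d) > 0" by simp
  obtain c where c: "dist x y = c" if "x \<in> \<omega>" "y \<in> \<omega>" "x \<noteq> y" for x y
    using simplex by (auto simp: regular_simplex_vertices_def)
  define r where "r = 1 - c\<^sup>2 / 2"
  have r: "x \<bullet> y = r" if "x \<in> \<omega>" "y \<in> \<omega>" "x \<noteq> y" for x y
  proof -
    have "c\<^sup>2 = 2 - 2 * (x \<bullet> y)"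
      using c[OF that] norm_diff_unit_sq[of x y] unit that by (simp add: dist_norm)
    then show ?thesis by (simp add: r_def diff_divide_distrib)
  qed
  have "\<not> is_singleton \<omega>" "\<omega> \<noteq> {}" using card d by (auto simp: is_singleton_altdef)
  then obtain p q where pq: "p \<in> \<omega>" "q \<in> \<omega>" "p \<noteq> q"
    by (metis is_singletonI')
  have "c > 0" using c[OF pq] pq by auto
  then have r1: "1 - r > 0" by (simp add: r_def)
  have const: "(1 - r) * a z = - r * sum a \<omega>"
    if "(\<Sum>y\<in>\<omega>. a y *\<^sub>R y) = 0" "z \<in> \<omega>" for a z
    by (rule equiangular_relation_constant[OF fin unit r that])
  have "dependent \<omega>" using card by (intro dependent_biggerset) auto
  then obtain a v where a: "(\<Sum>y\<in>\<omega>. a y *\<^sub>R y) = 0" "v \<in> \<omega>" "a v \<noteq> 0"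
    unfolding dependent_finite[OF fin] by auto
  have a_eq: "a y = a v" if "y \<in> \<omega>" for y
  proof -
    have "(1 - r) * a y = (1 - r) * a v"
      using const[OF a(1) that] const[OF a(1,2)] by simp
    then show ?thesis using r1 by simp
  qed
  have "(\<Sum>y\<in>\<omega>. a y *\<^sub>R y) = a v *\<^sub>R \<Sum>\<omega>"
    unfolding scaleR_sum_right by (rule sum.cong) (use a_eq in auto)
  then show sum0: "\<Sum>\<omega> = 0" using a by simp
  have "(1 - r) * 1 = - r * (\<Sum>y\<in>\<omega>. 1)"
    by (rule const[of "\<lambda>_. 1" p]) (use sum0 pq in auto)
  then have rd: "r * real CARD('d) = - 1" using card by (simp add: algebra_simps)
  then have r_eq: "r = - 1 / real CARD('d)" using d by (simp add: field_simps)
  show "x \<bullet> y = - 1 / real CARD('d)" if "x \<in> \<omega>" "y \<in> \<omega>" "x \<noteq> y" for x y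
    using r[OF that] r_eq by simp
  have "r \<noteq> 0" using rd by auto
  have "independent (\<omega> - {p})"
  proof
    assume "dependent (\<omega> - {p})"
    then obtain b w where b: "(\<Sum>y\<in>\<omega> - {p}. b y *\<^sub>R y) = 0" "w \<in> \<omega> - {p}" "b w \<noteq> 0"
      using dependent_finite[of "\<omega> - {p}"] fin by auto
    define b' where "b' = b(p := 0)"
    have "(\<Sum>y\<in>\<omega>. b' y *\<^sub>R y) = b' p *\<^sub>R p + (\<Sum>y\<in>\<omega> - {p}. b' y *\<^sub>R y)"
      using fin pq by (simp add: sum.remove)
    also have "(\<Sum>y\<in>\<omega> - {p}. b' y *\<^sub>R y) = (\<Sum>y\<in>\<omega> - {p}. b y *\<^sub>R y)"
      by (rule sum.cong) (auto simp: b'_def)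
    finally have rel: "(\<Sum>y\<in>\<omega>. b' y *\<^sub>R y) = 0" using b by (simp add: b'_def)
    have "(1 - r) * b' w = (1 - r) * b' p"
      using const[OF rel, of w] const[OF rel, of p] b pq by auto
    then show False using r1 b by (auto simp: b'_def)
  qed
  moreover have "card (\<omega> - {p}) = CARD('d)" using card pq fin by simp
  ultimately have "span (\<omega> - {p}) = UNIV"
    using card_ge_dim_independent[of "\<omega> - {p}" UNIV] by auto
  then show "span \<omega> = UNIV" using span_mono[of "\<omega> - {p}" \<omega>] by auto
qed

text \<open>
  The vertices form a tight frame: every vertex \<open>z\<close> is an eigenvector of
  \<open>v \<mapsto> \<Sum> (v \<bullet> y) y\<close> for the same eigenvalue \<open>1 + 1/d\<close>, because the vertices
  other than \<open>z\<close> sum to \<open>-z\<close>. As the vertices span the space, this map is a scalar.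
\<close>
lemma regular_simplex_sum_inner_sq:
  fixes \<omega> :: "(real ^ 'd) set"
  assumes simplex: "regular_simplex_vertices \<omega>"
  shows "(\<Sum>y\<in>\<omega>. (x \<bullet> y)\<^sup>2) = (1 + 1 / real CARD('d)) * (x \<bullet> x)"
proof -
  have fin: "finite \<omega>" by (rule regular_simplex_finite[OF simplex])
  \<comment> \<open>The frame operator minus the scalar that it is to be shown equal to.\<close>
  define T where "T v = (\<Sum>y\<in>\<omega>. (v \<bullet> y) *\<^sub>R y) - (1 + 1 / real CARD('d)) *\<^sub>R v" for v
  have lin: "linear T"
    unfolding T_def
    by (intro linear_compose_sub linear_compose_sum ballI)
      (auto intro!: linearI simp: inner_add_left scaleR_add_left scaleR_add_right)
  have "T z = 0" if z: "z \<in> \<omega>" for z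
  proof -
    have "(\<Sum>y\<in>\<omega>. (z \<bullet> y) *\<^sub>R y) = (z \<bullet> z) *\<^sub>R z + (\<Sum>y\<in>\<omega> - {z}. (z \<bullet> y) *\<^sub>R y)"
      using fin z by (simp add: sum.remove)
    also have "(\<Sum>y\<in>\<omega> - {z}. (z \<bullet> y) *\<^sub>R y) = (- 1 / real CARD('d)) *\<^sub>R \<Sum>(\<omega> - {z})"
      unfolding scaleR_sum_right
      by (rule sum.cong) (use regular_simplex_inner[OF simplex] z in auto)
    also have "\<Sum>(\<omega> - {z}) = - z"
      using fin z regular_simplex_sum[OF simplex] by (simp add: sum_diff1)
    finally show ?thesis
      using regular_simplex_unit[OF simplex z]
      by (simp add: T_def norm_eq_1 scaleR_add_left)
  qed
  then have "T x = 0"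
    using linear_eq_0_on_span[OF lin, of \<omega> x] regular_simplex_span[OF simplex] by auto
  then have eq: "(\<Sum>y\<in>\<omega>. (x \<bullet> y) *\<^sub>R y) = (1 + 1 / real CARD('d)) *\<^sub>R x"
    by (simp add: T_def)
  have "(\<Sum>y\<in>\<omega>. (x \<bullet> y)\<^sup>2) = (\<Sum>y\<in>\<omega>. (x \<bullet> y) * (y \<bullet> x))"
    by (rule sum.cong) (auto simp: power2_eq_square inner_commute)
  also have "\<dots> = (\<Sum>y\<in>\<omega>. (x \<bullet> y) *\<^sub>R y) \<bullet> x" by (simp add: inner_sum_left)
  finally show ?thesis unfolding eq by simp
qed

lemma quadratic_potential_constant:
  fixes \<omega> :: "(real ^ 'd) set"
  assumes simplex: "regular_simplex_vertices \<omega>" and x: "norm x = 1"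
  shows "(\<Sum>y\<in>\<omega>. \<alpha> + \<beta> * (norm (x - y))\<^sup>2 + \<gamma> * ((norm (x - y))\<^sup>2)\<^sup>2)
    = (real CARD('d) + 1) * (\<alpha> + 2 * \<beta> + 4 * \<gamma>) + 4 * \<gamma> * (1 + 1 / real CARD('d))"
proof -
  have card: "card \<omega> = CARD('d) + 1" using simplex by (simp add: regular_simplex_vertices_def)
  have lin: "(\<Sum>y\<in>\<omega>. x \<bullet> y) = 0"
    using regular_simplex_sum[OF simplex] by (simp flip: inner_sum_right)
  have quad: "(\<Sum>y\<in>\<omega>. (x \<bullet> y)\<^sup>2) = 1 + 1 / real CARD('d)"
    using regular_simplex_sum_inner_sq[OF simplex, of x] x by (simp add: norm_eq_1)
  have "(\<Sum>y\<in>\<omega>. \<alpha> + \<beta> * (norm (x - y))\<^sup>2 + \<gamma> * ((norm (x - y))\<^sup>2)\<^sup>2)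
      = (\<Sum>y\<in>\<omega>. (\<alpha> + 2 * \<beta> + 4 * \<gamma>) - (2 * \<beta> + 8 * \<gamma>) * (x \<bullet> y) + 4 * \<gamma> * (x \<bullet> y)\<^sup>2)"
    by (rule sum.cong[OF refl],
        simp only: norm_diff_unit_sq[OF x regular_simplex_unit[OF simplex]])
      (simp add: algebra_simps power2_eq_square)
  also have "\<dots> = (real CARD('d) + 1) * (\<alpha> + 2 * \<beta> + 4 * \<gamma>)
      - (2 * \<beta> + 8 * \<gamma>) * (\<Sum>y\<in>\<omega>. x \<bullet> y) + 4 * \<gamma> * (\<Sum>y\<in>\<omega>. (x \<bullet> y)\<^sup>2)"
    by (simp add: sum.distrib sum_subtractf card flip: sum_distrib_left)
  finally show ?thesis using lin quad by simp
qed

lemma antipode_sum: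
  fixes \<omega> :: "(real ^ 'd) set" and F :: "real \<Rightarrow> real"
  assumes simplex: "regular_simplex_vertices \<omega>" and z: "z \<in> \<omega>"
  shows "(\<Sum>y\<in>\<omega>. F ((norm (- z - y))\<^sup>2)) = F 4 + real CARD('d) * F (2 - 2 / real CARD('d))"
proof -
  have fin: "finite \<omega>" by (rule regular_simplex_finite[OF simplex])
  have card: "card (\<omega> - {z}) = CARD('d)"
    using simplex fin z by (simp add: regular_simplex_vertices_def)
  have nz: "norm z = 1" by (rule regular_simplex_unit[OF simplex z])
  have sq: "(norm (- z - y))\<^sup>2 = 2 + 2 * (z \<bullet> y)" if "y \<in> \<omega>" for y
    using norm_diff_unit_sq[of "- z" y] nz regular_simplex_unit[OF simplex that] by simp
  have "(\<Sum>y\<in>\<omega>. F ((norm (- z - y))\<^sup>2))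
      = F ((norm (- z - z))\<^sup>2) + (\<Sum>y\<in>\<omega> - {z}. F ((norm (- z - y))\<^sup>2))"
    using fin z by (simp add: sum.remove)
  also have "(norm (- z - z))\<^sup>2 = 4" using sq[OF z] nz by (simp add: norm_eq_1)
  also have "(\<Sum>y\<in>\<omega> - {z}. F ((norm (- z - y))\<^sup>2))
      = (\<Sum>y\<in>\<omega> - {z}. F (2 - 2 / real CARD('d)))"
    by (rule sum.cong) (use sq regular_simplex_inner[OF simplex] z in auto)
  finally show ?thesis by (simp add: card)
qed

text \<open>
  Squared distance \<open>4\<close> means antipodal. If instead all squared distances were
  \<open>2 - 2/d\<close>, their mean would be too, but the mean is always \<open>2\<close>.
\<close>
lemma exists_off_node_distance:
  fixes \<omega> :: "(real ^ 'd) set"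
  assumes simplex: "regular_simplex_vertices \<omega>" and x: "norm x = 1" "x \<notin> uminus ` \<omega>"
  obtains y where "y \<in> \<omega>" "(norm (x - y))\<^sup>2 \<noteq> 4"
    "(norm (x - y))\<^sup>2 \<noteq> 2 - 2 / real CARD('d)"
proof -
  have not4: "(norm (x - y))\<^sup>2 \<noteq> 4" if y: "y \<in> \<omega>" for y
  proof
    assume *: "(norm (x - y))\<^sup>2 = 4"
    have ny: "norm y = 1" by (rule regular_simplex_unit[OF simplex y])
    have "x \<bullet> y = - 1" using * norm_diff_unit_sq[OF x(1) ny] by simp
    then have "(norm (x - - y))\<^sup>2 = 0" using norm_diff_unit_sq[of x "- y"] x(1) ny by simp
    then have "x = - y" by (simp add: eq_neg_iff_add_eq_0)
    then show False using x(2) y by auto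
  qed
  have "\<exists>y\<in>\<omega>. (norm (x - y))\<^sup>2 \<noteq> 2 - 2 / real CARD('d)"
  proof (rule ccontr)
    assume "\<not> ?thesis"
    then have "(\<Sum>y\<in>\<omega>. (norm (x - y))\<^sup>2) = (\<Sum>y\<in>\<omega>. 2 - 2 / real CARD('d))"
      by (intro sum.cong) auto
    also have "\<dots> = (real CARD('d) + 1) * (2 - 2 / real CARD('d))"
      using simplex by (simp add: regular_simplex_vertices_def)
    finally have "(real CARD('d) + 1) * 2 = (real CARD('d) + 1) * (2 - 2 / real CARD('d))"
      using quadratic_potential_constant[OF simplex x(1), of 0 1 0] by simp
    then show False
      by (subst (asm) mult_left_cancel) (use of_nat_0_le_iff[of "CARD('d)"] in auto)
  qed
  then show thesis using not4 that by blast
qed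

lemma sq_distance_range:
  assumes "regular_simplex_vertices \<omega>" "norm x = 1" "y \<in> \<omega>"
  shows "(norm (x - y))\<^sup>2 \<in> {0..4}"
proof -
  have "norm (x - y) \<le> 2"
    using norm_triangle_ineq4[of x y] regular_simplex_unit[OF assms(1,3)] assms(2) by simp
  then have "(norm (x - y))\<^sup>2 \<le> 2\<^sup>2" by (intro power_mono) auto
  then show ?thesis by simp
qed

section \<open>Extrema of the potential\<close>

text \<open>
  Continuity on the closed interval is meant in the extended reals, so that it includes the
  limit at \<open>0\<close> whether or not \<open>f 0\<close> is finite.
\<close>
lemma potential_bounds:
  fixes f :: "real \<Rightarrow> ereal" and f' :: "real \<Rightarrow> real" and \<omega> :: "(real ^ 'd) set"
  assumes dim: "CARD('d) \<ge> 2"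
    and f_not_MInf: "\<And>t. t \<in> {0..4} \<Longrightarrow> f t \<noteq> -\<infinity>"
    and f_finite: "\<And>t. t \<in> {0<..4} \<Longrightarrow> f t \<noteq> \<infinity>"
    and f_cont: "continuous_on {0..4} f"
    and f_deriv: "\<And>t. t \<in> {0<..<4} \<Longrightarrow>
          ((\<lambda>s. real_of_ereal (f s)) has_real_derivative f' t) (at t)"
    and f'_concave: "concave_on {0<..<4} f'"
    and simplex: "regular_simplex_vertices \<omega>"
  defines "m \<equiv> f 4 + ereal (real CARD('d)) * f (2 - 2 / real CARD('d))"
  shows potential_at_antipode: "x \<in> uminus ` \<omega> \<Longrightarrow> potential f \<omega> x = m"
    and potential_lower_bound: "norm x = 1 \<Longrightarrow> m \<le> potential f \<omega> x"
    and potential_lower_bound_strict: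
      "strictly_concave_on {0<..<4} f' \<Longrightarrow> norm x = 1 \<Longrightarrow> x \<notin> uminus ` \<omega>
        \<Longrightarrow> m < potential f \<omega> x"
proof -
  define d where "d = real CARD('d)"
  define c where "c = 2 - 2 / d"
  define F where "F s = real_of_ereal (f s)" for s
  define h where "h = hermite_quadratic F (f' c) c 4"
  have "d \<ge> 2" using dim by (simp add: d_def)
  then have c: "0 < c" "c < 4" by (auto simp: c_def field_simps)
  have fin: "finite \<omega>" by (rule regular_simplex_finite[OF simplex])
  have fF: "f t = ereal (F t)" if "t \<in> {0..4}" "f t \<noteq> \<infinity>" for t
    using f_not_MInf[OF that(1)] that(2) unfolding F_def by (cases "f t") auto
  have fF': "f t = ereal (F t)" if "0 < t" "t \<le> 4" for t
    using fF[of t] f_finite[of t] that by auto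
  have m: "m = ereal (F 4 + d * F c)"
    unfolding m_def d_def[symmetric] c_def[symmetric] using fF'[of 4] fF'[of c] c by simp
  have bound: "ereal (h t) \<le> f t \<and>
      (strictly_concave_on {0<..<4} f' \<longrightarrow> t \<noteq> c \<longrightarrow> t \<noteq> 4 \<longrightarrow> ereal (h t) < f t)"
    if t: "t \<in> {0..4}" for t
  proof (cases "f t = \<infinity>")
    case False
    \<comment> \<open>Interpolation needs an interval on which \<open>f\<close> is finite; this one reaches \<open>0\<close>
      only if \<open>t = 0\<close>, in which case \<open>f 0\<close> is finite.\<close>
    define a where "a = min t (c / 2)"
    have a: "0 \<le> a" "a < c" "t \<in> {a..4}" using t c by (auto simp: a_def)
    have fa: "f s \<noteq> \<infinity>" if "s \<in> {a..4}" for s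
      using f_finite[of s] that False t c by (cases "s = 0") (auto simp: a_def min_def split: if_splits)
    have "continuous_on {a..4} f"
      using f_cont by (rule continuous_on_subset) (use a in auto)
    then have "continuous_on {a..4} (real_of_ereal \<circ> f)"
      using fa f_not_MInf a by (subst continuous_on_iff_real[symmetric]) auto
    then have cont: "continuous_on {a..4} F" by (simp add: F_def comp_def)
    have der: "(F has_real_derivative f' s) (at s)" if "s \<in> {a<..<4}" for s
      unfolding F_def using f_deriv[of s] that a by auto
    have conc: "concave_on {a<..<4} f'"
      using f'_concave a unfolding concave_on_iff by (auto simp: convex_real_interval)
    have strict: "strictly_concave_on {a<..<4} f'" if "strictly_concave_on {0<..<4} f'"
      using that a unfolding strictly_concave_on_def by (auto simp: convex_real_interval)
    show ?thesis
      using hermite_quadratic_le[OF cont der a(2) c(2) conc a(3)] strict fF[OF t False]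
      by (auto simp: h_def)
  qed auto
  have h_sum: "(\<Sum>y\<in>\<omega>. h ((norm (x - y))\<^sup>2)) = F 4 + d * F c" if x: "norm x = 1" for x
  proof -
    obtain \<alpha> \<beta> \<gamma> where h: "\<And>s. h s = \<alpha> + \<beta> * s + \<gamma> * s\<^sup>2"
      unfolding h_def using hermite_quadratic_coeffs by blast
    obtain z where z: "z \<in> \<omega>"
      using simplex by (fastforce simp: regular_simplex_vertices_def)
    have "(\<Sum>y\<in>\<omega>. h ((norm (x - y))\<^sup>2)) = (\<Sum>y\<in>\<omega>. h ((norm (- z - y))\<^sup>2))"
      unfolding h using quadratic_potential_constant[OF simplex] x
        regular_simplex_unit[OF simplex z] by simp
    also have "\<dots> = h 4 + d * h c"
      using antipode_sum[OF simplex z] by (simp add: d_def c_def)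
    finally show ?thesis
      using hermite_quadratic_nodes c by (simp add: h_def)
  qed
  show "potential f \<omega> x = m" if x: "x \<in> uminus ` \<omega>"
  proof -
    obtain z where z: "z \<in> \<omega>" "x = - z" using x by auto
    have "f ((norm (x - y))\<^sup>2) = ereal (F ((norm (x - y))\<^sup>2))" if y: "y \<in> \<omega>" for y
    proof (rule fF')
      have unit: "norm y = 1" "norm z = 1" using regular_simplex_unit[OF simplex] y z by auto
      have sq: "(norm (x - y))\<^sup>2 = 2 + 2 * (z \<bullet> y)"
        using norm_diff_unit_sq[of "- z" y] unit z by simp
      have "z \<bullet> y = 1 \<or> z \<bullet> y = - 1 / d"
        using regular_simplex_inner[OF simplex z(1) y] unit
        by (cases "z = y") (auto simp: d_def norm_eq_1)
      moreover have "1 / d \<le> 1 / 2" using \<open>d \<ge> 2\<close> by (intro divide_left_mono) auto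
      ultimately show "0 < (norm (x - y))\<^sup>2" unfolding sq by auto
      show "(norm (x - y))\<^sup>2 \<le> 4"
        using sq_distance_range[OF simplex _ y, of x] unit z by simp
    qed
    then have "potential f \<omega> x = ereal (\<Sum>y\<in>\<omega>. F ((norm (x - y))\<^sup>2))"
      unfolding potential_def by (simp flip: sum_ereal cong: sum.cong)
    then show ?thesis
      using antipode_sum[OF simplex z(1), of F] z(2) by (simp add: m d_def c_def)
  qed
  show "m \<le> potential f \<omega> x" if x: "norm x = 1"
  proof -
    have "m = (\<Sum>y\<in>\<omega>. ereal (h ((norm (x - y))\<^sup>2)))" using h_sum[OF x] m by simp
    also have "\<dots> \<le> potential f \<omega> x"
      unfolding potential_def using bound sq_distance_range[OF simplex x] by (intro sum_mono) auto
    finally show ?thesis .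
  qed
  show "m < potential f \<omega> x"
    if strict: "strictly_concave_on {0<..<4} f'" and x: "norm x = 1" "x \<notin> uminus ` \<omega>"
  proof -
    define s where "s y = (norm (x - y))\<^sup>2" for y
    have s: "s y \<in> {0..4}" if "y \<in> \<omega>" for y
      unfolding s_def using sq_distance_range[OF simplex x(1) that] .
    obtain y where y: "y \<in> \<omega>" "s y \<noteq> 4" "s y \<noteq> c"
      using exists_off_node_distance[OF simplex x] unfolding s_def c_def d_def by blast
    have "m = ereal (\<Sum>y\<in>\<omega>. h (s y))" using h_sum[OF x(1)] m by (simp add: s_def)
    also have "\<dots> = ereal (h (s y)) + ereal (\<Sum>y\<in>\<omega> - {y}. h (s y))"
      using fin y by (simp add: sum.remove)
    \<comment> \<open>The other summands stay finite here: adding an infinite one would destroy strictness.\<close>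
    also have "\<dots> < f (s y) + ereal (\<Sum>y\<in>\<omega> - {y}. h (s y))"
      using bound[OF s[OF y(1)]] strict y by (cases "f (s y)") auto
    also have "\<dots> \<le> f (s y) + (\<Sum>y\<in>\<omega> - {y}. f (s y))"
      unfolding sum_ereal[symmetric] using bound s
      by (intro add_left_mono sum_mono) auto
    also have "\<dots> = potential f \<omega> x"
      unfolding potential_def s_def[symmetric] using fin y(1) by (simp add: sum.remove)
    finally show ?thesis .
  qed
qed

text \<open>
  Finiteness lets negation distribute over the sum, which in the extended reals fails when opposite
  infinities meet.
\<close>
lemma potential_reflection:
  fixes \<omega> :: "(real ^ 'd) set"
  assumes simplex: "regular_simplex_vertices \<omega>" and x: "norm x = 1"
    and fin: "\<And>t. t \<in> {0..4} \<Longrightarrow> \<bar>f t\<bar> \<noteq> \<infinity>"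
  shows "potential f \<omega> x = - potential (\<lambda>s. - f (4 - s)) \<omega> (- x)"
proof -
  define F where "F s = real_of_ereal (f s)" for s
  have fF: "f ((norm (x - y))\<^sup>2) = ereal (F ((norm (x - y))\<^sup>2))" if "y \<in> \<omega>" for y
    unfolding F_def using fin[OF sq_distance_range[OF simplex x that]] by (simp add: ereal_real')
  have opp: "4 - (norm (- x - y))\<^sup>2 = (norm (x - y))\<^sup>2" if "y \<in> \<omega>" for y
    using norm_diff_unit_sq[of x y] norm_diff_unit_sq[of "- x" y] x
      regular_simplex_unit[OF simplex that] by simp
  have "potential (\<lambda>s. - f (4 - s)) \<omega> (- x) = (\<Sum>y\<in>\<omega>. ereal (- F ((norm (x - y))\<^sup>2)))"
    unfolding potential_def by (rule sum.cong) (simp_all only: opp fF uminus_ereal.simps refl)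
  moreover have "potential f \<omega> x = (\<Sum>y\<in>\<omega>. ereal (F ((norm (x - y))\<^sup>2)))"
    unfolding potential_def by (rule sum.cong) (simp_all only: fF refl)
  ultimately show ?thesis by (simp add: sum_negf)
qed

theorem theorem2p4:
  fixes f :: "real \<Rightarrow> ereal"
    and f' :: "real \<Rightarrow> real"
    and \<omega> :: "(real ^ 'd) set"
  assumes dim: "CARD('d) \<ge> 2"
    and f_not_MInf: "\<And>t. t \<in> {0..4} \<Longrightarrow> f t \<noteq> -\<infinity>"
    and f_finite: "\<And>t. t \<in> {0<..4} \<Longrightarrow> f t \<noteq> \<infinity>"
    and f_cont: "continuous_on {0<..4} f"
    and f_deriv: "\<And>t. t \<in> {0<..<4} \<Longrightarrow>
          ((\<lambda>s. real_of_ereal (f s)) has_real_derivative f' t) (at t)"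
    and f'_concave: "concave_on {0<..<4} f'"
    and f_lim: "(f \<longlongrightarrow> f 0) (at_right 0)"
    and simplex: "regular_simplex_vertices \<omega>"
  shows "(\<forall>x \<in> uminus ` \<omega>. is_arg_min (potential f \<omega>) (\<lambda>y. y \<in> sphere 0 1) x)
    \<and> min_potential f \<omega>
        = f 4 + ereal (real CARD('d)) * f (2 - 2 / real CARD('d))
    \<and> (f 0 < \<infinity> \<longrightarrow>
         (\<forall>x \<in> \<omega>. is_arg_max (potential f \<omega>) (\<lambda>y. y \<in> sphere 0 1) x)
         \<and> max_potential f \<omega>
             = f 0 + ereal (real CARD('d)) * f (2 + 2 / real CARD('d)))
    \<and> (strictly_concave_on {0<..<4} f' \<longrightarrow>
         (\<forall>x. is_arg_min (potential f \<omega>) (\<lambda>y. y \<in> sphere 0 1) x \<longrightarrow> x \<in> uminus ` \<omega>)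
         \<and> (f 0 < \<infinity> \<longrightarrow>
              (\<forall>x. is_arg_max (potential f \<omega>) (\<lambda>y. y \<in> sphere 0 1) x \<longrightarrow> x \<in> \<omega>)))"
proof -
  define m where "m = f 4 + ereal (real CARD('d)) * f (2 - 2 / real CARD('d))"
  have sphere: "y \<in> sphere 0 1" if "y \<in> \<omega>" for y
    using regular_simplex_unit[OF simplex that] by simp
  obtain z where z: "z \<in> \<omega>"
    using simplex by (fastforce simp: regular_simplex_vertices_def)
  have cont0: "continuous_on {0..4} f"
    unfolding continuous_on_def
  proof
    fix t :: real assume t: "t \<in> {0..4}"
    show "(f \<longlongrightarrow> f t) (at t within {0..4})"
    proof (cases "t = 0")
      case True
      then show ?thesis using f_lim by (simp add: at_within_Icc_at_right)
    next
      case False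
      have "(f \<longlongrightarrow> f t) (at t within {0<..4})"
        using f_cont t False unfolding continuous_on_def by auto
      also have "at t within {0<..4} = at t within {0..4}"
        by (rule at_within_nhd[of _ "{0<..}"]) (use t False in auto)
      finally show ?thesis .
    qed
  qed
  note low = potential_bounds[OF dim f_not_MInf f_finite cont0 f_deriv f'_concave simplex,
      folded m_def]
  have at: "potential f \<omega> x = m" if "x \<in> uminus ` \<omega>" for x using low(1) that by blast
  have ge: "m \<le> potential f \<omega> x" if "norm x = 1" for x using low(2) that by blast
  have gt: "m < potential f \<omega> x"
    if "strictly_concave_on {0<..<4} f'" "norm x = 1" "x \<notin> uminus ` \<omega>" for x
    using low(3) that by blast
  have min: "is_arg_min (potential f \<omega>) (\<lambda>y. y \<in> sphere 0 1) x" if "x \<in> uminus ` \<omega>" for x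
    unfolding is_arg_min_def using at[OF that] ge that sphere by (auto simp: not_less)
  have min_val: "min_potential f \<omega> = m"
    unfolding min_potential_def
  proof (rule Least_equality)
    show "m \<in> potential f \<omega> ` sphere 0 1"
      using at[of "- z"] z sphere[OF z] by (intro image_eqI[of _ _ "- z"]) auto
  qed (use ge in auto)
  have min_strict: "x \<in> uminus ` \<omega>" if "strictly_concave_on {0<..<4} f'"
    "is_arg_min (potential f \<omega>) (\<lambda>y. y \<in> sphere 0 1) x" for x
  proof (rule ccontr)
    assume "x \<notin> uminus ` \<omega>"
    then have "m < potential f \<omega> x" using gt that by (auto simp: is_arg_min_def)
    then show False
      using that at[of "- z"] z sphere[OF z] by (auto simp: is_arg_min_def dest: spec[of _ "- z"])
  qed
  have max: "(\<forall>x \<in> \<omega>. is_arg_max (potential f \<omega>) (\<lambda>y. y \<in> sphere 0 1) x)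
      \<and> max_potential f \<omega> = f 0 + ereal (real CARD('d)) * f (2 + 2 / real CARD('d))
      \<and> (strictly_concave_on {0<..<4} f' \<longrightarrow>
          (\<forall>x. is_arg_max (potential f \<omega>) (\<lambda>y. y \<in> sphere 0 1) x \<longrightarrow> x \<in> \<omega>))"
    if f0: "f 0 < \<infinity>"
  proof -
    define g where "g s = - f (4 - s)" for s
    define g' where "g' s = f' (4 - s)" for s
    define M where "M = f 0 + ereal (real CARD('d)) * f (2 + 2 / real CARD('d))"
    have fin: "\<bar>f t\<bar> \<noteq> \<infinity>" if "t \<in> {0..4}" for t
      using f_not_MInf[OF that] f_finite[of t] f0 that by (cases "t = 0") auto
    have g_fin: "\<bar>g t\<bar> \<noteq> \<infinity>" if "t \<in> {0..4}" for t
      unfolding g_def using fin[of "4 - t"] that by simp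
    have g_cont: "continuous_on {0..4} g"
      unfolding g_def
      by (rule continuous_on_compose2[OF continuous_uminus_ereal[of UNIV]],
          rule continuous_on_compose2[OF cont0]) (auto intro!: continuous_intros)
    have g_deriv: "((\<lambda>s. real_of_ereal (g s)) has_real_derivative g' t) (at t)"
      if "t \<in> {0<..<4}" for t
    proof -
      have "((\<lambda>s. real_of_ereal (f (4 - s))) has_real_derivative f' (4 - t) * (- 1)) (at t)"
        by (rule DERIV_chain2[where f = "\<lambda>s. real_of_ereal (f s)" and g = "\<lambda>s. 4 - s"])
          (use f_deriv[of "4 - t"] that in \<open>auto intro!: derivative_eq_intros\<close>)
      from DERIV_minus[OF this] show ?thesis by (simp add: g_def g'_def)
    qed
    have refl_comb: "4 - (u * x + v * y) = u * (4 - x) + v * (4 - y)" if "u + v = 1"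
      for u v x y :: real
    proof -
      have "u = 1 - v" using that by simp
      show ?thesis unfolding \<open>u = 1 - v\<close> by (simp add: algebra_simps)
    qed
    have g'_conc: "concave_on {0<..<4} g'"
      using f'_concave unfolding concave_on_iff g'_def by (auto simp: refl_comb)
    have g'_strict: "strictly_concave_on {0<..<4} g'" if "strictly_concave_on {0<..<4} f'"
      using that unfolding strictly_concave_on_def g'_def by (auto simp: refl_comb)
    have M: "g 4 + ereal (real CARD('d)) * g (2 - 2 / real CARD('d)) = - M"
    proof -
      have "2 + 2 / real CARD('d) \<in> {0..4}" using dim by (auto simp: field_simps)
      from fin[OF this] fin[of 0] show ?thesis
        unfolding M_def g_def
        by (cases "f 0"; cases "f (2 + 2 / real CARD('d))") auto
    qed
    have g_not_MInf: "g t \<noteq> -\<infinity>" if "t \<in> {0..4}" for t using g_fin[OF that] by auto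
    have g_finite: "g t \<noteq> \<infinity>" if "t \<in> {0<..4}" for t using g_fin[of t] that by auto
    note low = potential_bounds[OF dim g_not_MInf g_finite g_cont g_deriv g'_conc simplex,
        unfolded M]
    have refl: "potential f \<omega> x = - potential g \<omega> (- x)" if "norm x = 1" for x
      unfolding g_def by (rule potential_reflection[OF simplex that]) (erule fin)
    have at: "potential f \<omega> x = M" if "x \<in> \<omega>" for x
      using refl[of x] low(1)[of "- x"] that sphere[OF that] by simp
    have le: "potential f \<omega> x \<le> M" if "norm x = 1" for x
      using refl[OF that] low(2)[of "- x"] that by (simp add: ereal_uminus_le_reorder)
    have lt: "potential f \<omega> x < M"
      if "strictly_concave_on {0<..<4} f'" "norm x = 1" "x \<notin> \<omega>" for x
    proof -
      have "- x \<notin> uminus ` \<omega>" using that by auto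
      then show ?thesis
        using refl[OF that(2)] low(3)[of "- x"] that g'_strict
        by (auto simp: ereal_uminus_less_reorder)
    qed
    have "is_arg_max (potential f \<omega>) (\<lambda>y. y \<in> sphere 0 1) x" if "x \<in> \<omega>" for x
      unfolding is_arg_max_def using at[OF that] le that sphere by (auto simp: not_less)
    moreover have "max_potential f \<omega> = M"
      unfolding max_potential_def
    proof (rule Greatest_equality)
      show "M \<in> potential f \<omega> ` sphere 0 1"
        using at[OF z] sphere[OF z] by (intro image_eqI[of _ _ z]) auto
    qed (use le in auto)
    moreover have "x \<in> \<omega>" if "strictly_concave_on {0<..<4} f'"
      "is_arg_max (potential f \<omega>) (\<lambda>y. y \<in> sphere 0 1) x" for x
    proof (rule ccontr)
      assume "x \<notin> \<omega>"
      then have "potential f \<omega> x < M" using lt that by (auto simp: is_arg_max_def)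
      then show False
        using that at[OF z] sphere[OF z] by (auto simp: is_arg_max_def)
    qed
    ultimately show ?thesis unfolding M_def by blast
  qed
  show ?thesis
    using min min_val min_strict max unfolding m_def by blast
qed

end
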